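(* Let $\mathbf{X},\mathbf{Y},\mathbf{Z}$ be finite nonempty sets and let $P$ be a positive probability measure on $\mathbf{X}\times\mathbf{Y}\times\mathbf{Z}$ (every element has positive probability), with $(X,Y,Z)$ denoting random variables with joint distribution $P$. Fix $x\in\mathbf{X}$ and an integer $N\ge 1$, and let $(X_n,Y_n,Z_n)$, $n\in[N]$, be an IID sample from $P$. For $y\in\mathbf{Y}$ let $$p_y:=\sum_{z\in\mathbf{Z}}P(Z=z)\,P(Y=y\mid X=x,Z=z)$$ and $$F_y:=\sum_{z\in\mathbf{Z}}\frac{|\{n\in[N]:Z_n=z\}|+1}{N+1}\times\frac{|\{n\in[N]:(X_n,Y_n,Z_n)=(x,y,z)\}|+1}{|\{n\in[N]:(X_n,Z_n)=(x,z)\}|+1}.$$ Then for each $y\in\mathbf{Y}$, $$\mathbb{E}\,\frac{p_y}{F_y}\le 1.$$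
   Context: For a positive integer $N$, $[N]:=\{1,\dots,N\}$. Finite sets carry the discrete $\sigma$-algebra, and $|A|$ denotes the cardinality of a finite set $A$. The expectation is over the random sample $(X_n,Y_n,Z_n)$, $n\in[N]$ (on which $F_y$ depends). *)

theory Defs
  imports "HOL-Probability.Probability"
begin

definition adjusted_prob ::
  "('x \<times> 'y \<times> 'z) measure \<Rightarrow> 'z set \<Rightarrow> 'x \<Rightarrow> 'y \<Rightarrow> real" where
  "adjusted_prob P ZZ x y =
     (\<Sum>z\<in>ZZ. \<P>((x', y', z') in P. z' = z)
            * \<P>((x', y', z') in P. y' = y \<bar> x' = x \<and> z' = z))"

text \<open>Here \<open>X\<close>, \<open>Y\<close>, \<open>Z\<close> are the realized values of the sample at the indices \<open>1, \<dots>, N\<close>.\<close>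

definition smoothed_estimate ::
  "nat \<Rightarrow> 'z set \<Rightarrow> (nat \<Rightarrow> 'x) \<Rightarrow> (nat \<Rightarrow> 'y) \<Rightarrow> (nat \<Rightarrow> 'z) \<Rightarrow> 'x \<Rightarrow> 'y \<Rightarrow> real" where
  "smoothed_estimate N ZZ X Y Z x y =
     (\<Sum>z\<in>ZZ. (real (card {n \<in> {1..N}. Z n = z}) + 1) / (real N + 1)
            * ((real (card {n \<in> {1..N}. (X n, Y n, Z n) = (x, y, z)}) + 1)
               / (real (card {n \<in> {1..N}. (X n, Z n) = (x, z)}) + 1)))"

end

theory Submission
  imports Defs
begin

text \<open>
  Write the numerator as \<open>p = (\<Sum>z. a z)\<close> with \<open>a z = P(Z = z) P(Y = y | X = x, Z = z)\<close>, and the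
  denominator as \<open>F = (\<Sum>z. F z)\<close>.  Since \<open>t \<mapsto> 1 / t\<close> is convex, averaging the numbers
  \<open>F z / a z\<close> with the weights \<open>a z / p\<close> gives
  \<open>p / F \<le> (\<Sum>z. (a z / p) * (a z / F z))\<close> (Titu's form of the Cauchy--Schwarz inequality).  The
  weights do not depend on the sample, so it is enough that \<open>a z / F z\<close> has expectation at most 1
  for every single \<open>z\<close>.

  For a fixed \<open>z\<close>, let \<open>K\<close>, \<open>A\<close>, \<open>B\<close> count the sample points in the decreasing events
  \<open>Z = z\<close>, \<open>(X, Z) = (x, z)\<close>, \<open>(X, Y, Z) = (x, y, z)\<close>.  Given \<open>A\<close>, the count \<open>B\<close> is binomial with
  \<open>A\<close> trials, and a binomial count \<open>B\<close> with \<open>n\<close> trials of success probability \<open>q\<close> satisfies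
  \<open>E (q (n + 1) / (B + 1)) = 1 - (1 - q) ^ (n + 1) \<le> 1\<close>,
  which is why every count carries the correction \<open>+ 1\<close>.  Hence the conditional expectation of
  \<open>P(Y = y | X = x, Z = z) (A + 1) / (B + 1)\<close> is at most 1.  What remains is
  \<open>P(Z = z) (N + 1) / (K + 1)\<close>, to which the same bound applies.

  The conditioning is carried out by finite sums: the sample is recorded by the chain of index
  sets \<open>B \<subseteq> A \<subseteq> S\<close> on which the three events occur.  By independence each chain has a product
  probability, and the binomial bound is applied to the sum over \<open>B\<close> and then to the sum over
  \<open>S\<close>, the sum over \<open>A\<close> in between being a plain binomial expansion.
\<close>

section \<open>Sums over subsets with binomial weights\<close>

lemma sum_Pow_card:
  fixes h :: "nat \<Rightarrow> real"
  assumes "finite A"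
  shows "(\<Sum>B\<in>Pow A. h (card B)) = (\<Sum>k\<le>card A. real (card A choose k) * h k)"
proof -
  have "(\<Sum>B\<in>Pow A. h (card B)) = (\<Sum>k\<le>card A. \<Sum>B | B \<in> Pow A \<and> card B = k. h (card B))"
    using assms by (intro sum.group[symmetric]) (auto intro: card_mono)
  also have "\<dots> = (\<Sum>k\<le>card A. real (card A choose k) * h k)"
    using n_subsets[OF assms] by (intro sum.cong) auto
  finally show ?thesis .
qed

lemma sum_Pow_binomial:
  fixes a b :: real
  assumes "finite A"
  shows "(\<Sum>B\<in>Pow A. a ^ card B * b ^ card (A - B)) = (a + b) ^ card A"
  using prod_add[OF assms, of "\<lambda>_. a" "\<lambda>_. b"] by simp

text \<open>
  Without normalisation of \<open>a + b\<close>, this is the bound on the expectation of \<open>1 / (B + 1)\<close> for a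
  binomial count \<open>B\<close>.  Absorbing \<open>1 / (k + 1)\<close> into the binomial coefficient turns the sum into
  the expansion of \<open>(a + b) ^ (n + 1)\<close> without its term \<open>b ^ (n + 1)\<close>.
\<close>

lemma sum_Pow_binomial_inverse_le:
  fixes a b :: real
  assumes "finite A" "a > 0" "b \<ge> 0"
  shows "(\<Sum>B\<in>Pow A. a ^ card B * b ^ card (A - B) / (real (card B) + 1))
           \<le> (a + b) ^ (card A + 1) / (a * (real (card A) + 1))"
proof -
  define n where "n = card A"
  have "(\<Sum>B\<in>Pow A. a ^ card B * b ^ card (A - B) / (real (card B) + 1))
          = (\<Sum>B\<in>Pow A. a ^ card B * b ^ (n - card B) / (real (card B) + 1))"
    using assms(1) by (intro sum.cong) (auto simp: n_def card_Diff_subset finite_subset)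
  also have "\<dots> = (\<Sum>k\<le>n. real (n choose k) * (a ^ k * b ^ (n - k) / (real k + 1)))"
    unfolding n_def by (rule sum_Pow_card[OF assms(1)])
  also have "\<dots> = (\<Sum>k\<le>n. real (Suc n choose Suc k) * a ^ Suc k * b ^ (Suc n - Suc k))
                     / (a * (real n + 1))"
    unfolding sum_divide_distrib
  proof (rule sum.cong[OF refl])
    fix k
    have "(real k + 1) * real (Suc n choose Suc k) = (real n + 1) * real (n choose k)"
      using arg_cong[OF Suc_times_binomial[of k n], of real]
      by (simp del: binomial_Suc_Suc add: algebra_simps)
    then have "real (n choose k) = (real k + 1) * real (Suc n choose Suc k) / (real n + 1)"
      by (simp add: field_simps del: binomial_Suc_Suc)
    then show "real (n choose k) * (a ^ k * b ^ (n - k) / (real k + 1)) =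
        real (Suc n choose Suc k) * a ^ Suc k * b ^ (Suc n - Suc k) / (a * (real n + 1))"
      using assms(2) by (simp del: binomial_Suc_Suc)
  qed
  also have "\<dots> \<le> (a + b) ^ Suc n / (a * (real n + 1))"
  proof (rule divide_right_mono)
    have "(a + b) ^ Suc n = (\<Sum>k\<le>Suc n. real (Suc n choose k) * a ^ k * b ^ (Suc n - k))"
      by (rule binomial_ring)
    also have "\<dots> = b ^ Suc n +
        (\<Sum>k\<le>n. real (Suc n choose Suc k) * a ^ Suc k * b ^ (Suc n - Suc k))"
      by (subst sum.atMost_Suc_shift) (simp del: binomial_Suc_Suc)
    finally show "(\<Sum>k\<le>n. real (Suc n choose Suc k) * a ^ Suc k * b ^ (Suc n - Suc k))
        \<le> (a + b) ^ Suc n"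
      using assms(3) by (simp del: binomial_Suc_Suc power_Suc)
  qed (use assms(2) in auto)
  finally show ?thesis by (simp add: n_def)
qed

text \<open>
  The weights are the probabilities of \<open>B \<subseteq> A \<subseteq> S\<close> for trials with nested success events of
  probabilities \<open>e \<le> d \<le> c\<close>.  The factor \<open>A + 1\<close> cancels the denominator that the sum over \<open>B\<close>
  produces, so the sum over \<open>A\<close> collapses to \<open>c ^ card S\<close>.
\<close>

lemma sum_chain_ratio_le:
  fixes c d e :: real
  assumes I: "finite I" and e: "0 < e" "e \<le> d" "d \<le> c" "c \<le> 1"
  shows "(\<Sum>S\<in>Pow I. \<Sum>A\<in>Pow S. \<Sum>B\<in>Pow A.
            (c * (e / d)) / ((real (card S) + 1) / (real (card I) + 1)
               * ((real (card B) + 1) / (real (card A) + 1)))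
            * (e ^ card B * (d - e) ^ card (A - B) * (c - d) ^ card (S - A)
               * (1 - c) ^ card (I - S))) \<le> 1"
proof -
  define m where "m = real (card I) + 1"
  have m: "m > 0" by (simp add: m_def)
  have cd: "d > 0" "c > 0" using e by auto
  define w where "w S = c * m / (real (card S) + 1) * (1 - c) ^ card (I - S)" for S
  have w: "w S \<ge> 0" for S using cd m e by (simp add: w_def)
  have inner: "(\<Sum>B\<in>Pow A. (c * (e / d)) / ((real (card S) + 1) / m
               * ((real (card B) + 1) / (real (card A) + 1)))
            * (e ^ card B * (d - e) ^ card (A - B) * (c - d) ^ card (S - A)
               * (1 - c) ^ card (I - S)))
          \<le> w S * (d ^ card A * (c - d) ^ card (S - A))"
    if A: "finite A" for A S
  proof -
    let ?v = "w S * (c - d) ^ card (S - A) * (e / d) * (real (card A) + 1)"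
    have v: "?v \<ge> 0" using w[of S] e cd by simp
    have "(\<Sum>B\<in>Pow A. (c * (e / d)) / ((real (card S) + 1) / m
               * ((real (card B) + 1) / (real (card A) + 1)))
            * (e ^ card B * (d - e) ^ card (A - B) * (c - d) ^ card (S - A)
               * (1 - c) ^ card (I - S)))
        = ?v * (\<Sum>B\<in>Pow A. e ^ card B * (d - e) ^ card (A - B) / (real (card B) + 1))"
      unfolding sum_distrib_left by (intro sum.cong) (auto simp: w_def mult_ac)
    also have "\<dots> \<le> ?v * ((e + (d - e)) ^ (card A + 1) / (e * (real (card A) + 1)))"
      using A e v by (intro mult_left_mono sum_Pow_binomial_inverse_le) auto
    also have "\<dots> = w S * (d ^ card A * (c - d) ^ card (S - A))"
    proof -
      define k where "k = real (card A) + 1"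
      have "k \<noteq> 0" unfolding k_def by linarith
      then show ?thesis unfolding k_def[symmetric] using e cd by simp
    qed
    finally show ?thesis .
  qed
  have "(\<Sum>S\<in>Pow I. \<Sum>A\<in>Pow S. \<Sum>B\<in>Pow A. (c * (e / d)) / ((real (card S) + 1) / m
               * ((real (card B) + 1) / (real (card A) + 1)))
            * (e ^ card B * (d - e) ^ card (A - B) * (c - d) ^ card (S - A)
               * (1 - c) ^ card (I - S)))
      \<le> (\<Sum>S\<in>Pow I. \<Sum>A\<in>Pow S. w S * (d ^ card A * (c - d) ^ card (S - A)))"
    using I by (intro sum_mono inner) (auto intro: finite_subset)
  also have "\<dots> = (\<Sum>S\<in>Pow I. w S * c ^ card S)"
  proof (rule sum.cong[OF refl])
    fix S assume "S \<in> Pow I"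
    then have "finite S" using I by (auto intro: finite_subset)
    from sum_Pow_binomial[OF this, of d "c - d"]
    show "(\<Sum>A\<in>Pow S. w S * (d ^ card A * (c - d) ^ card (S - A))) = w S * c ^ card S"
      by (simp add: sum_distrib_left[symmetric])
  qed
  also have "\<dots> = c * m * (\<Sum>S\<in>Pow I. c ^ card S * (1 - c) ^ card (I - S) / (real (card S) + 1))"
    unfolding sum_distrib_left by (intro sum.cong) (auto simp: w_def)
  also have "\<dots> \<le> c * m * ((c + (1 - c)) ^ (card I + 1) / (c * (real (card I) + 1)))"
    using cd e m I by (intro mult_left_mono sum_Pow_binomial_inverse_le) auto
  also have "\<dots> = 1" using cd m by (simp add: m_def)
  finally show ?thesis by (simp add: m_def)
qed

section \<open>Counts of nested events in an independent sample\<close>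

text \<open>
  The event says, for each single index, in which of the four differences of consecutive sets
  of the chain \<open>E \<subseteq> D \<subseteq> C \<subseteq> space P\<close> the sample point lies.
\<close>

lemma (in prob_space) prob_index_chain:
  fixes W :: "'i \<Rightarrow> 'a \<Rightarrow> 'b"
  assumes I: "finite I" "I \<noteq> {}"
    and W: "indep_vars (\<lambda>_. P) W I" "\<And>n. n \<in> I \<Longrightarrow> distr M P (W n) = P"
    and sets: "C \<in> sets P" "D \<in> sets P" "E \<in> sets P" and sub: "E \<subseteq> D" "D \<subseteq> C"
    and chain: "B \<subseteq> A" "A \<subseteq> S" "S \<subseteq> I"
  defines "V \<equiv> {\<omega> \<in> space M. {n \<in> I. W n \<omega> \<in> C} = S \<and> {n \<in> I. W n \<omega> \<in> D} = A
                   \<and> {n \<in> I. W n \<omega> \<in> E} = B}"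
  shows "V \<in> events"
    and "prob V = measure P E ^ card B * (measure P D - measure P E) ^ card (A - B)
           * (measure P C - measure P D) ^ card (S - A) * (1 - measure P C) ^ card (I - S)"
proof -
  define G where "G n = (if n \<in> B then E else if n \<in> A then D - E
                          else if n \<in> S then C - D else space P - C)" for n
  have meas: "W n \<in> measurable M P" if "n \<in> I" for n
    using W(1) that by (auto simp: indep_vars_def)
  have G: "G n \<in> sets P" for n using sets by (auto simp: G_def)
  have V: "V = (\<Inter>n\<in>I. W n -` G n \<inter> space M)"
  proof (intro set_eqI iffI)
    fix \<omega> assume "\<omega> \<in> V"
    then show "\<omega> \<in> (\<Inter>n\<in>I. W n -` G n \<inter> space M)"
      using meas[THEN measurable_space] by (auto simp: V_def G_def)
  next
    fix \<omega> assume *: "\<omega> \<in> (\<Inter>n\<in>I. W n -` G n \<inter> space M)"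
    then have \<omega>: "\<omega> \<in> space M" using I by auto
    have "(W n \<omega> \<in> C \<longleftrightarrow> n \<in> S) \<and> (W n \<omega> \<in> D \<longleftrightarrow> n \<in> A) \<and> (W n \<omega> \<in> E \<longleftrightarrow> n \<in> B)"
      if "n \<in> I" for n
    proof -
      have "W n \<omega> \<in> G n" using * that by blast
      then show ?thesis using sub chain unfolding G_def by (auto split: if_splits)
    qed
    then show "\<omega> \<in> V" using \<omega> chain unfolding V_def by blast
  qed
  show "V \<in> events"
    unfolding V using I meas G by (intro sets.finite_INT) (auto intro: measurable_sets)
  have P: "prob_space P"
    using I W(2) meas prob_space_distr by (metis all_not_in_conv)
  then interpret P: prob_space P .
  have "prob V = (\<Prod>n\<in>I. measure P (G n))"
    unfolding V using indep_varsD_finite[OF W(1) I(2,1) G] W(2) measure_distr[OF meas G]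
    by simp
  also have "\<dots> = (\<Prod>n\<in>B. measure P (G n)) * (\<Prod>n\<in>A-B. measure P (G n))
      * (\<Prod>n\<in>S-A. measure P (G n)) * (\<Prod>n\<in>I-S. measure P (G n))"
    using I(1) chain by (metis finite_subset mult.commute prod.subset_diff)
  also have "(\<Prod>n\<in>B. measure P (G n)) = measure P E ^ card B"
    by (simp add: G_def)
  also have "(\<Prod>n\<in>A-B. measure P (G n)) = (measure P D - measure P E) ^ card (A - B)"
    using sub sets by (simp add: G_def P.finite_measure_Diff)
  also have "(\<Prod>n\<in>S-A. measure P (G n)) = (measure P C - measure P D) ^ card (S - A)"
  proof -
    have "measure P (G n) = measure P C - measure P D" if "n \<in> S - A" for n
      using that chain sub sets by (auto simp: G_def P.finite_measure_Diff)
    then show ?thesis by simp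
  qed
  also have "(\<Prod>n\<in>I-S. measure P (G n)) = (1 - measure P C) ^ card (I - S)"
  proof -
    have "measure P (G n) = 1 - measure P C" if "n \<in> I - S" for n
      using that chain sets P.prob_compl by (auto simp: G_def)
    then show ?thesis by simp
  qed
  finally show "prob V = measure P E ^ card B * (measure P D - measure P E) ^ card (A - B)
           * (measure P C - measure P D) ^ card (S - A) * (1 - measure P C) ^ card (I - S)" .
qed

text \<open>
  The ratio takes one value for each of the finitely many chains of index sets, so its
  expectation is the finite sum bounded above.
\<close>

lemma (in prob_space) expectation_nested_count_ratio_le_1:
  fixes W :: "'i \<Rightarrow> 'a \<Rightarrow> 'b"
  assumes I: "finite I" "I \<noteq> {}"
    and W: "indep_vars (\<lambda>_. P) W I" "\<And>n. n \<in> I \<Longrightarrow> distr M P (W n) = P"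
    and sets: "C \<in> sets P" "D \<in> sets P" "E \<in> sets P" and sub: "E \<subseteq> D" "D \<subseteq> C"
    and pos: "measure P E > 0"
  defines "R \<equiv> \<lambda>\<omega>. (measure P C * (measure P E / measure P D))
      / ((real (card {n \<in> I. W n \<omega> \<in> C}) + 1) / (real (card I) + 1)
         * ((real (card {n \<in> I. W n \<omega> \<in> E}) + 1) / (real (card {n \<in> I. W n \<omega> \<in> D}) + 1)))"
  shows "integrable M R" and "expectation R \<le> 1"
proof -
  define r where "r S A B = (measure P C * (measure P E / measure P D))
      / ((real (card S) + 1) / (real (card I) + 1)
         * ((real (card B) + 1) / (real (card A) + 1)))" for S A B :: "'i set"
  define V where "V S A B = {\<omega> \<in> space M. {n \<in> I. W n \<omega> \<in> C} = S \<and> {n \<in> I. W n \<omega> \<in> D} = A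
                   \<and> {n \<in> I. W n \<omega> \<in> E} = B}" for S A B
  define T where "T = (SIGMA S:Pow I. SIGMA A:Pow S. Pow A)"
  have fin: "finite T"
    using I(1) unfolding T_def by (intro finite_SigmaI) (auto intro: finite_subset)
  have V: "V S A B \<in> events"
    "prob (V S A B) = measure P E ^ card B * (measure P D - measure P E) ^ card (A - B)
       * (measure P C - measure P D) ^ card (S - A) * (1 - measure P C) ^ card (I - S)"
    if "(S, A, B) \<in> T" for S A B
    using prob_index_chain[OF I W sets sub, of B A S] that by (auto simp: V_def T_def)
  have "has_bochner_integral M
      (\<lambda>\<omega>. \<Sum>(S, A, B)\<in>T. r S A B * indicator (V S A B) \<omega>)
      (\<Sum>(S, A, B)\<in>T. r S A B * prob (V S A B))"
  proof (intro has_bochner_integral_sum)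
    fix t assume "t \<in> T"
    moreover obtain S A B where "t = (S, A, B)" by (cases t)
    ultimately show "has_bochner_integral M
        (\<lambda>\<omega>. case t of (S, A, B) \<Rightarrow> r S A B * indicator (V S A B) \<omega>)
        (case t of (S, A, B) \<Rightarrow> r S A B * prob (V S A B))"
      using V(1)[of S A B] by (auto intro!: has_bochner_integral_mult_right
        has_bochner_integral_real_indicator simp: less_top[symmetric])
  qed
  moreover have "(\<Sum>(S, A, B)\<in>T. r S A B * indicator (V S A B) \<omega>) = R \<omega>"
    if "\<omega> \<in> space M" for \<omega>
  proof -
    define t where "t = ({n \<in> I. W n \<omega> \<in> C}, {n \<in> I. W n \<omega> \<in> D}, {n \<in> I. W n \<omega> \<in> E})"
    have "t \<in> T" using sub by (auto simp: t_def T_def)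
    have "(\<Sum>(S, A, B)\<in>T. r S A B * indicator (V S A B) \<omega>)
        = (\<Sum>s\<in>T. if s = t then R \<omega> else 0)"
      using that by (intro sum.cong) (auto simp: t_def V_def r_def R_def indicator_def)
    also have "\<dots> = R \<omega>" using fin \<open>t \<in> T\<close> by simp
    finally show ?thesis .
  qed
  ultimately have R: "has_bochner_integral M R (\<Sum>(S, A, B)\<in>T. r S A B * prob (V S A B))"
    by (simp cong: has_bochner_integral_cong)
  then show "integrable M R" by (rule integrable.intros)
  have P: "prob_space P"
    using I W prob_space_distr unfolding indep_vars_def by (metis all_not_in_conv)
  then interpret P: prob_space P .
  have "expectation R = (\<Sum>(S, A, B)\<in>T. r S A B *
      (measure P E ^ card B * (measure P D - measure P E) ^ card (A - B)
       * (measure P C - measure P D) ^ card (S - A) * (1 - measure P C) ^ card (I - S)))"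
    unfolding has_bochner_integral_integral_eq[OF R] by (intro sum.cong) (auto simp: V(2))
  also have "\<dots> = (\<Sum>S\<in>Pow I. \<Sum>A\<in>Pow S. \<Sum>B\<in>Pow A. r S A B *
      (measure P E ^ card B * (measure P D - measure P E) ^ card (A - B)
       * (measure P C - measure P D) ^ card (S - A) * (1 - measure P C) ^ card (I - S)))"
    unfolding T_def using I(1)
    by (subst sum.Sigma[symmetric])
       (auto intro!: sum.cong sum.Sigma[symmetric] finite_SigmaI intro: finite_subset
             simp: finite_subset)
  also have "\<dots> \<le> 1"
    unfolding r_def using I(1) pos P.finite_measure_mono[OF sub(1) sets(2)]
      P.finite_measure_mono[OF sub(2) sets(1)] P.prob_le_1
    by (intro sum_chain_ratio_le)
  finally show "expectation R \<le> 1" .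
qed

section \<open>Convexity and the bound for the estimate\<close>

text \<open>
  Titu's inequality \<open>(\<Sum> a)\<^sup>2 / (\<Sum> f) \<le> (\<Sum> a\<^sup>2 / f)\<close>, divided by \<open>\<Sum> a\<close>.
\<close>

lemma sum_divide_sum_le_weighted_sum:
  fixes a f :: "'i \<Rightarrow> real"
  assumes "finite J" "J \<noteq> {}" and a: "\<And>i. i \<in> J \<Longrightarrow> a i > 0" and f: "\<And>i. i \<in> J \<Longrightarrow> f i > 0"
  shows "(\<Sum>i\<in>J. a i) / (\<Sum>i\<in>J. f i) \<le> (\<Sum>i\<in>J. a i / (\<Sum>j\<in>J. a j) * (a i / f i))"
proof -
  have pos: "(\<Sum>i\<in>J. a i) > 0" "(\<Sum>i\<in>J. f i) > 0"
    using assms by (auto intro: sum_pos)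
  have "(\<Sum>i\<in>J. a i)\<^sup>2 = (\<Sum>i\<in>J. (a i / sqrt (f i)) * sqrt (f i))\<^sup>2"
    using f by (intro arg_cong[where f = "\<lambda>s. s\<^sup>2"] sum.cong) (simp_all add: less_imp_neq[symmetric])
  also have "\<dots> \<le> (\<Sum>i\<in>J. (a i / sqrt (f i))\<^sup>2) * (\<Sum>i\<in>J. (sqrt (f i))\<^sup>2)"
    by (rule Cauchy_Schwarz_ineq_sum)
  also have "\<dots> = (\<Sum>i\<in>J. a i * (a i / f i)) * (\<Sum>i\<in>J. f i)"
  proof -
    have "(\<Sum>i\<in>J. (a i / sqrt (f i))\<^sup>2) = (\<Sum>i\<in>J. a i * (a i / f i))"
      using f by (intro sum.cong) (auto simp: power_divide power2_eq_square less_imp_le)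
    moreover have "(\<Sum>i\<in>J. (sqrt (f i))\<^sup>2) = (\<Sum>i\<in>J. f i)"
      using f by (intro sum.cong) (auto simp: less_imp_le)
    ultimately show ?thesis by simp
  qed
  finally have "(\<Sum>i\<in>J. a i)\<^sup>2 \<le> (\<Sum>i\<in>J. a i * (a i / f i)) * (\<Sum>i\<in>J. f i)" .
  then have "(\<Sum>i\<in>J. a i) / (\<Sum>i\<in>J. f i) \<le> (\<Sum>i\<in>J. a i * (a i / f i)) / (\<Sum>j\<in>J. a j)"
    using pos by (simp add: field_simps power2_eq_square)
  also have "\<dots> = (\<Sum>i\<in>J. a i / (\<Sum>j\<in>J. a j) * (a i / f i))"
    by (simp add: sum_divide_distrib mult_ac)
  finally show ?thesis .
qed

theorem lemma1:
  fixes XX :: "'x set" and YY :: "'y set" and ZZ :: "'z set"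
    and P :: "('x \<times> 'y \<times> 'z) measure"
    and M :: "'w measure"
    and X :: "nat \<Rightarrow> 'w \<Rightarrow> 'x" and Y :: "nat \<Rightarrow> 'w \<Rightarrow> 'y" and Z :: "nat \<Rightarrow> 'w \<Rightarrow> 'z"
    and N :: nat and x :: 'x and y :: 'y
  assumes "finite XX" "XX \<noteq> {}" "finite YY" "YY \<noteq> {}" "finite ZZ" "ZZ \<noteq> {}"
    and "prob_space P"
    and "sets P = Pow (XX \<times> YY \<times> ZZ)"
    and "\<And>w. w \<in> XX \<times> YY \<times> ZZ \<Longrightarrow> measure P {w} > 0"
    and "x \<in> XX"
    and "N \<ge> 1"
    and "prob_space M"
    and "prob_space.indep_vars M (\<lambda>_. P) (\<lambda>n \<omega>. (X n \<omega>, Y n \<omega>, Z n \<omega>)) {1..N}"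
    and "\<And>n. n \<in> {1..N} \<Longrightarrow> distr M P (\<lambda>\<omega>. (X n \<omega>, Y n \<omega>, Z n \<omega>)) = P"
    and "y \<in> YY"
  shows "prob_space.expectation M
           (\<lambda>\<omega>. adjusted_prob P ZZ x y
                 / smoothed_estimate N ZZ (\<lambda>n. X n \<omega>) (\<lambda>n. Y n \<omega>) (\<lambda>n. Z n \<omega>) x y) \<le> 1"
proof -
  interpret P: prob_space P by fact
  interpret M: prob_space M by fact
  have space: "space P = XX \<times> YY \<times> ZZ"
    using sets_eq_imp_space_eq[of P "count_space (XX \<times> YY \<times> ZZ)"] assms(8) by simp
  define W where "W = (\<lambda>n \<omega>. (X n \<omega>, Y n \<omega>, Z n \<omega>))"
  have indep: "M.indep_vars (\<lambda>_. P) W {1..N}" and dist: "\<And>n. n \<in> {1..N} \<Longrightarrow> distr M P (W n) = P"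
    using assms(13,14) by (simp_all add: W_def)
  have W_space: "W n \<omega> \<in> space P" if "n \<in> {1..N}" "\<omega> \<in> space M" for n \<omega>
    using indep that by (auto simp: M.indep_vars_def intro: measurable_space)

  define C where "C z = {(x', y', z') \<in> space P. z' = z}" for z
  define D where "D z = {(x', y', z') \<in> space P. x' = x \<and> z' = z}" for z
  define E where "E z = {(x', y', z') \<in> space P. y' = y \<and> x' = x \<and> z' = z}" for z
  have sets: "C z \<in> sets P" "D z \<in> sets P" "E z \<in> sets P" for z
    unfolding assms(8) space C_def D_def E_def by auto
  have sub: "E z \<subseteq> D z" "D z \<subseteq> C z" for z by (auto simp: C_def D_def E_def)
  have E_pos: "measure P (E z) > 0" if "z \<in> ZZ" for z
  proof -
    have "E z = {(x, y, z)}" using that assms(10,15) by (auto simp: E_def space)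
    then show ?thesis using assms(9)[of "(x, y, z)"] that assms(10,15) by simp
  qed
  have D_pos: "measure P (D z) > 0" and C_pos: "measure P (C z) > 0" if "z \<in> ZZ" for z
    using E_pos[OF that] P.finite_measure_mono[OF sub(1)[of z] sets(2)]
      P.finite_measure_mono[OF sub(2)[of z] sets(1)] by linarith+

  define a where "a z = measure P (C z) * (measure P (E z) / measure P (D z))" for z
  define f where "f z \<omega> = (real (card {n \<in> {1..N}. W n \<omega> \<in> C z}) + 1) / (real N + 1)
    * ((real (card {n \<in> {1..N}. W n \<omega> \<in> E z}) + 1)
       / (real (card {n \<in> {1..N}. W n \<omega> \<in> D z}) + 1))" for z \<omega>
  have a_pos: "a z > 0" if "z \<in> ZZ" for z
    using E_pos[OF that] D_pos[OF that] C_pos[OF that] by (simp add: a_def)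
  have f_pos: "f z \<omega> > 0" for z \<omega>
    unfolding f_def by (intro mult_pos_pos divide_pos_pos) auto
  have p: "adjusted_prob P ZZ x y = (\<Sum>z\<in>ZZ. a z)"
    unfolding adjusted_prob_def a_def cond_prob_def C_def D_def E_def
    by (intro sum.cong refl arg_cong2[where f = "(*)"] arg_cong2[where f = "(/)"]
        arg_cong[where f = "measure P"]) auto
  have F: "smoothed_estimate N ZZ (\<lambda>n. X n \<omega>) (\<lambda>n. Y n \<omega>) (\<lambda>n. Z n \<omega>) x y = (\<Sum>z\<in>ZZ. f z \<omega>)"
    if "\<omega> \<in> space M" for \<omega>
  proof -
    have "{n \<in> {1..N}. W n \<omega> \<in> C z} = {n \<in> {1..N}. Z n \<omega> = z}"
      "{n \<in> {1..N}. W n \<omega> \<in> D z} = {n \<in> {1..N}. (X n \<omega>, Z n \<omega>) = (x, z)}"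
      "{n \<in> {1..N}. W n \<omega> \<in> E z} = {n \<in> {1..N}. (X n \<omega>, Y n \<omega>, Z n \<omega>) = (x, y, z)}" for z
      using W_space[OF _ that] by (auto simp: W_def C_def D_def E_def)
    then show ?thesis unfolding smoothed_estimate_def f_def by simp
  qed

  have int: "integrable M (\<lambda>\<omega>. a z / f z \<omega>)" and le_1: "M.expectation (\<lambda>\<omega>. a z / f z \<omega>) \<le> 1"
    if "z \<in> ZZ" for z
    using M.expectation_nested_count_ratio_le_1[of "{1..N}", OF _ _ indep dist
        sets(1-3)[of z] sub[of z] E_pos[OF that]] assms(11)
    by (simp_all add: a_def f_def)
  let ?p = "\<Sum>z\<in>ZZ. a z"
  have p_pos: "?p > 0" using assms(5,6) a_pos by (intro sum_pos) auto
  have "M.expectation (\<lambda>\<omega>. adjusted_prob P ZZ x y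
          / smoothed_estimate N ZZ (\<lambda>n. X n \<omega>) (\<lambda>n. Y n \<omega>) (\<lambda>n. Z n \<omega>) x y)
      \<le> M.expectation (\<lambda>\<omega>. \<Sum>z\<in>ZZ. a z / ?p * (a z / f z \<omega>))"
  proof (rule integral_mono')
    show "integrable M (\<lambda>\<omega>. \<Sum>z\<in>ZZ. a z / ?p * (a z / f z \<omega>))"
      using int by (intro Bochner_Integration.integrable_sum integrable_mult_right) auto
    show "adjusted_prob P ZZ x y
        / smoothed_estimate N ZZ (\<lambda>n. X n \<omega>) (\<lambda>n. Y n \<omega>) (\<lambda>n. Z n \<omega>) x y
      \<le> (\<Sum>z\<in>ZZ. a z / ?p * (a z / f z \<omega>))" if "\<omega> \<in> space M" for \<omega>
      unfolding p F[OF that] using assms(5,6) a_pos f_pos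
      by (rule sum_divide_sum_le_weighted_sum)
    show "0 \<le> (\<Sum>z\<in>ZZ. a z / ?p * (a z / f z \<omega>))" for \<omega>
      using a_pos f_pos p_pos
      by (intro sum_nonneg mult_nonneg_nonneg divide_nonneg_nonneg) (auto intro: less_imp_le)
  qed
  also have "\<dots> = (\<Sum>z\<in>ZZ. a z / ?p * M.expectation (\<lambda>\<omega>. a z / f z \<omega>))"
    using int by (subst Bochner_Integration.integral_sum)
      (intro integrable_mult_right, simp, simp only: integral_mult_right_zero)
  also have "\<dots> \<le> (\<Sum>z\<in>ZZ. a z / ?p * 1)"
    using le_1 a_pos p_pos by (intro sum_mono mult_left_mono) (auto intro: less_imp_le)
  also have "\<dots> = 1" using p_pos by (simp add: sum_divide_distrib[symmetric])
  finally show ?thesis .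
qed

end
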